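(* For $(m_1,m_2)\in\mathbb R^2$, the real maximum $\mathrm{js}_{\mathbb R}(m_1,m_2)$ (the maximum over the polygon $P$ of the $n^2$-coefficient $\delta_2$, as defined in the context) is given by $$ \mathrm{js}_{\mathbb R}(m_1,m_2)= \begin{cases} \frac{(m_1-1)^2}{4(m_1+m_2-1)}+\frac{3m_1+9m_2+3}{4} & \text{if } m_1>1,\ m_2\ge 0\\ \frac{3m_1+9m_2+3}{4} & \text{if } 0\le m_1\le 1,\ 1+m_1+3m_2\ge 0,\ 1-m_1+m_2\ge 0\\ \frac{m_1^2}{4(m_1+m_2+1)}+\frac{3m_1+9m_2+3}{4} & \text{if } m_1\le 0,\ m_2\ge 0,\ m_2\ge -1-2m_1\\ 2m_2+\frac12 & \text{if } m_2>0,\ 1+2m_1+m_2\le 0\\ \frac{(3m_2+1)^2}{4(m_2+\frac12)} & \text{if } -\frac13\le m_2\le 0,\ 1+2m_1+3m_2+4m_1m_2\le 0\\ 0 & \text{if } m_2\le -\frac13,\ 1+m_1+3m_2\le 0,\ 1+2m_1+4m_2\le 0,\ m_2\le -\frac23m_1\\ \frac{(2m_1+3m_2)^2}{4(m_1+m_2-\frac12)} & \text{if } m_2>-\frac23m_1,\ m_2\le -1\\ m_1+2m_2+\frac12 & \text{if } -1\le m_2\le 0,\ 1-m_1+m_2\le 0,\ 1+2m_1+4m_2\ge 0\\ I(m_1,m_2) & \text{if } 1+2m_1+3m_2+4m_1m_2\ge 0,\ -\frac12\le m_1\le 0,\ -\frac13\le m_2\le 0 \end{cases} $$ where $$ I(m_1,m_2)=\frac{3+6m_1+4m_1^2+18m_2+24m_1m_2+8m_1^2m_2+27m_2^2+18m_1m_2^2}{4(1+m_1+3m_2+2m_1m_2)}.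 $$ (At the single point $(0,-\frac13)$, where the expression for $I$ has zero denominator, the value is the one given by the other applicable lines.)
   Context: Define, for real $m_1,m_2,n,k_1,k_2$, $$ \begin{aligned} Q(m_1,m_2,n,k_1,k_2)={}&\tfrac{k_1}{2}-\tfrac{3k_1^2}{2}-3k_1k_2-k_2^2-k_1m_1-k_1^2m_1-k_2m_2-k_2^2m_2-6k_1n\\ &-3k_2n+2m_1n+4m_2n-k_2m_2n-2n^2+m_1n^2+2m_2n^2\\ &+\tfrac12\Big((1+8k_1+4k_2+8n)\,\ell-3\ell^2\Big), \end{aligned} $$ where $\ell=\min\{2k_1+n,\ 2k_1+k_2+n,\ k_2+2n\}$. (This is the $q$-degree of the summand of the fusion state sum for the colored Jones polynomial of the 2-fusion knot $K(m_1,m_2)$.) Let $P\subset\mathbb R^2$ be the polygon $P=\{(x_1,x_2)\mid 0\le x_1\le 1,\ |1-2x_1|\le 1+2x_2\le 1+2x_1\}$. For $x\in P$ and $n>0$, $Q(m_1,m_2,n,nx_1,nx_2)$ is a polynomial of degree at most $2$ in $n$; let $\delta_2(m_1,m_2,x)$ be its coefficient of $n^2$. Then $\mathrm{js}_{\mathbb R}(m_1,m_2):=\max\{\delta_2(m_1,m_2,x)\mid x\in P\}$. *)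

theory Defs
  imports "HOL-Analysis.Analysis" "HOL-Computational_Algebra.Polynomial"
begin

definition ell :: "real \<Rightarrow> real \<Rightarrow> real \<Rightarrow> real" where
  "ell n k1 k2 = min (2 * k1 + n) (min (2 * k1 + k2 + n) (k2 + 2 * n))"

text \<open>The \<open>q\<close>-degree of the summand of the fusion state sum for the colored Jones polynomial
  of the 2-fusion knot \<open>K(m1, m2)\<close>, extended to real arguments.\<close>

definition Q :: "real \<Rightarrow> real \<Rightarrow> real \<Rightarrow> real \<Rightarrow> real \<Rightarrow> real" where
  "Q m1 m2 n k1 k2 =
     k1 / 2 - 3 * k1^2 / 2 - 3 * k1 * k2 - k2^2 - k1 * m1 - k1^2 * m1 - k2 * m2 - k2^2 * m2
     - 6 * k1 * n - 3 * k2 * n + 2 * m1 * n + 4 * m2 * n - k2 * m2 * n - 2 * n^2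
     + m1 * n^2 + 2 * m2 * n^2
     + 1 / 2 * ((1 + 8 * k1 + 4 * k2 + 8 * n) * ell n k1 k2 - 3 * (ell n k1 k2)^2)"

definition P :: "(real \<times> real) set" where
  "P = {(x1, x2). 0 \<le> x1 \<and> x1 \<le> 1 \<and> \<bar>1 - 2 * x1\<bar> \<le> 1 + 2 * x2 \<and> 1 + 2 * x2 \<le> 1 + 2 * x1}"

text \<open>\<open>Q_poly m1 m2 x\<close> is the polynomial in \<open>n\<close> that agrees with \<open>Q(m1, m2, n, n x1, n x2)\<close> for
  all real \<open>n > 0\<close>; see \<open>Q_poly_ex1\<close> for its existence and uniqueness.\<close>

definition Q_poly :: "real \<Rightarrow> real \<Rightarrow> real \<times> real \<Rightarrow> real poly" where
  "Q_poly m1 m2 x =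
     (THE p. degree p \<le> 2 \<and> (\<forall>n>0. poly p n = Q m1 m2 n (n * fst x) (n * snd x)))"

definition delta2 :: "real \<Rightarrow> real \<Rightarrow> real \<times> real \<Rightarrow> real" where
  "delta2 m1 m2 x = coeff (Q_poly m1 m2 x) 2"

text \<open>The maximum is rendered by \<open>Greatest\<close>, the greatest element of the set of values, rather
  than by a supremum; \<open>js_R_is_max\<close> shows that it is attained.\<close>

definition js_R :: "real \<Rightarrow> real \<Rightarrow> real" where
  "js_R m1 m2 = (GREATEST v. v \<in> delta2 m1 m2 ` P)"

lemma ell_scale:
  assumes "n > 0"
  shows "ell n (n * a) (n * b) = n * ell 1 a b"
proof -
  have *: "n * min x y = min (n * x) (n * y)" for x y
    using assms by (simp add: min_mult_distrib_left)
  have "n * (2 * a + 1) = 2 * (n * a) + n" "n * (2 * a + b + 1) = 2 * (n * a) + n * b + n"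
    "n * (b + 2 * 1) = n * b + 2 * n"
    by (simp_all add: distrib_left)
  then show ?thesis
    unfolding ell_def * by (simp only:)
qed

definition delta2_explicit :: "real \<Rightarrow> real \<Rightarrow> real \<times> real \<Rightarrow> real" where
  "delta2_explicit m1 m2 x = (let x1 = fst x; x2 = snd x; L = ell 1 x1 x2 in
     - 3 * x1^2 / 2 - 3 * x1 * x2 - x2^2 - x1^2 * m1 - x2^2 * m2 - 6 * x1 - 3 * x2 - x2 * m2
     - 2 + m1 + 2 * m2 + 1 / 2 * ((8 * x1 + 4 * x2 + 8) * L - 3 * L^2))"

lemma Q_poly_unique:
  fixes p q :: "real poly"
  assumes "\<forall>n>0. poly p n = f n" "\<forall>n>0. poly q n = f n"
  shows "p = q"
proof (rule ccontr)
  assume "p \<noteq> q"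
  then have "finite {n. poly (p - q) n = 0}"
    by (intro poly_roots_finite) simp
  moreover have "{0<..} \<subseteq> {n. poly (p - q) n = 0}"
    using assms by auto
  ultimately have "finite {0::real<..}"
    using finite_subset by blast
  then show False
    using infinite_Ioi by blast
qed

definition Q_poly_explicit :: "real \<Rightarrow> real \<Rightarrow> real \<times> real \<Rightarrow> real poly" where
  "Q_poly_explicit m1 m2 x = [:0, fst x / 2 - fst x * m1 - snd x * m2 + 2 * m1 + 4 * m2
     + ell 1 (fst x) (snd x) / 2, delta2_explicit m1 m2 x:]"

lemma Q_poly_witness:
  "degree (Q_poly_explicit m1 m2 x) \<le> 2 \<and>
    (\<forall>n>0. poly (Q_poly_explicit m1 m2 x) n = Q m1 m2 n (n * fst x) (n * snd x))"
proof (intro conjI allI impI)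
  show "degree (Q_poly_explicit m1 m2 x) \<le> 2"
    by (simp add: Q_poly_explicit_def)
next
  fix n :: real
  assume n: "n > 0"
  obtain a b where x: "x = (a, b)" by (cases x)
  show "poly (Q_poly_explicit m1 m2 x) n = Q m1 m2 n (n * fst x) (n * snd x)"
    unfolding Q_poly_explicit_def Q_def delta2_explicit_def Let_def ell_scale[OF n] x fst_conv snd_conv
      poly_pCons poly_0 power2_eq_square
    by (simp only: add_divide_distrib diff_divide_distrib distrib_left distrib_right
        left_diff_distrib right_diff_distrib) (simp add: mult_ac)
qed

lemma Q_poly_ex1:
  "\<exists>!p. degree p \<le> 2 \<and> (\<forall>n>0. poly p n = Q m1 m2 n (n * fst x) (n * snd x))"
proof (rule ex1I)
  show "degree (Q_poly_explicit m1 m2 x) \<le> 2 \<and>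
    (\<forall>n>0. poly (Q_poly_explicit m1 m2 x) n = Q m1 m2 n (n * fst x) (n * snd x))"
    by (rule Q_poly_witness)
next
  fix p
  assume "degree p \<le> 2 \<and> (\<forall>n>0. poly p n = Q m1 m2 n (n * fst x) (n * snd x))"
  then show "p = Q_poly_explicit m1 m2 x"
    using Q_poly_unique[where f = "\<lambda>n. Q m1 m2 n (n * fst x) (n * snd x)"] Q_poly_witness
    by simp
qed

lemma Q_poly:
  "degree (Q_poly m1 m2 x) \<le> 2"
  "n > 0 \<Longrightarrow> poly (Q_poly m1 m2 x) n = Q m1 m2 n (n * fst x) (n * snd x)"
  using theI'[OF Q_poly_ex1[of m1 m2 x], folded Q_poly_def] by simp_all

lemma delta2_eq: "delta2 m1 m2 x = delta2_explicit m1 m2 x"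
proof -
  have "Q_poly m1 m2 x = Q_poly_explicit m1 m2 x"
    unfolding Q_poly_def
    by (rule the1_equality[OF Q_poly_ex1 Q_poly_witness])
  then show ?thesis
    by (simp add: delta2_def Q_poly_explicit_def numeral_2_eq_2)
qed

lemma continuous_on_delta2: "continuous_on S (delta2 m1 m2)"
proof -
  have "delta2 m1 m2 = delta2_explicit m1 m2"
    by (rule ext) (rule delta2_eq)
  then show ?thesis
    unfolding delta2_explicit_def Let_def ell_def by (simp only:) (intro continuous_intros; simp)
qed

lemma compact_P: "compact P"
proof -
  have "P = {x. 0 \<le> fst x} \<inter> {x. fst x \<le> 1} \<inter> {x. \<bar>1 - 2 * fst x\<bar> \<le> 1 + 2 * snd x}
      \<inter> {x. 1 + 2 * snd x \<le> 1 + 2 * fst x}"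
    by (auto simp: P_def)
  moreover have "closed \<dots>"
    by (intro closed_Int closed_Collect_le continuous_intros)
  moreover have "P \<subseteq> cbox (0, -1) (1, 1)"
    by (auto simp: P_def cbox_Pair_eq)
  ultimately show ?thesis
    by (metis bounded_cbox bounded_subset compact_eq_bounded_closed)
qed

lemma js_R_is_max:
  "js_R m1 m2 \<in> delta2 m1 m2 ` P"
  "x \<in> P \<Longrightarrow> delta2 m1 m2 x \<le> js_R m1 m2"
proof -
  have "(0, 0) \<in> P" by (simp add: P_def)
  then obtain y where y: "y \<in> P" "\<forall>x\<in>P. delta2 m1 m2 x \<le> delta2 m1 m2 y"
    using continuous_attains_sup[OF compact_P _ continuous_on_delta2] by blast
  then have "js_R m1 m2 = delta2 m1 m2 y"
    unfolding js_R_def by (intro Greatest_equality) auto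
  with y show "js_R m1 m2 \<in> delta2 m1 m2 ` P" "x \<in> P \<Longrightarrow> delta2 m1 m2 x \<le> js_R m1 m2"
    by auto
qed

text \<open>In the region where \<open>I_val\<close> is used, its denominator vanishes only at
  \<open>(0, - 1/3)\<close>.\<close>

definition I_val :: "real \<Rightarrow> real \<Rightarrow> real" where
  "I_val m1 m2 =
     (3 + 6 * m1 + 4 * m1^2 + 18 * m2 + 24 * m1 * m2 + 8 * m1^2 * m2 + 27 * m2^2 + 18 * m1 * m2^2)
     / (4 * (1 + m1 + 3 * m2 + 2 * m1 * m2))"

end

theory Submission
  imports Defs
begin

text \<open>For a fixed point \<open>(a, b)\<close> of \<open>P\<close>, the value \<open>delta2 m1 m2 (a, b)\<close> is affine in \<open>(m1, m2)\<close>.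
  On the cells where the claimed maximum is affine as well, the upper bound therefore only has to be
  checked at the vertices \<open>(1, 0)\<close>, \<open>(1/2, -1/2)\<close>, \<open>(3/2, -1)\<close>, \<open>(0, -1/3)\<close> and along the unbounded
  directions; the cell \<open>m2 \<le> -1\<close>, \<open>m2 > - 2/3 m1\<close> is a cone with apex \<open>(3/2, -1)\<close>, which leaves a
  homogeneous inequality. For \<open>m2 \<ge> 0\<close> the value decreases in \<open>b\<close>, so the maximum sits on the two
  lower edges of \<open>P\<close>. For \<open>m1 \<le> 0\<close> the value increases in \<open>a\<close> as long as \<open>ell\<close> is not given by
  \<open>b + 2\<close>, and in the remaining part of \<open>P\<close> one completes squares.\<close>

section \<open>Explicit quadratic formulas on the polygon\<close>

lemma delta2_shift:
  "delta2 m1 m2 (a, b) = delta2 n1 n2 (a, b) + (m1 - n1) * (1 - a^2) + (m2 - n2) * (2 - b - b^2)"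
  by (simp add: delta2_eq delta2_explicit_def Let_def algebra_simps)

text \<open>\<open>P\<close> is the quadrilateral with vertices \<open>(0, 0)\<close>,
  \<open>(1/2, -1/2)\<close>, \<open>(1, 0)\<close>, \<open>(1, 1)\<close>; the bounds
  \<open>- a \<le> b\<close> and \<open>b \<le> a\<close> together encode
  \<open>0 \<le> a\<close>.\<close>

lemma P_iff: "(a, b) \<in> P \<longleftrightarrow> - a \<le> b \<and> a - 1 \<le> b \<and> b \<le> a \<and> a \<le> 1"
  unfolding P_def by auto

text \<open>Here and in the next two lemmas the hypotheses select which of the three linear forms in
  \<open>ell\<close> is smallest; the three regions meet at \<open>(1/2, 0)\<close>.\<close>

lemma delta2_lower_left:
  assumes "2 * a \<le> 1" "b \<le> 0"
  shows "delta2 m1 m2 (a, b) =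
    a^2 / 2 - a * b - b^2 / 2 + 1 / 2 + m1 * (1 - a^2) + m2 * (2 - b - b^2)"
proof -
  have "ell 1 a b = 2 * a + b + 1"
    using assms by (simp add: ell_def)
  then show ?thesis
    by (simp add: delta2_eq delta2_explicit_def Let_def) (simp add: power2_eq_square field_simps)
qed

lemma delta2_upper_left:
  assumes "0 \<le> b" "2 * a - 1 \<le> b"
  shows "delta2 m1 m2 (a, b) =
    a^2 / 2 + a * b - b^2 - b + 1 / 2 + m1 * (1 - a^2) + m2 * (2 - b - b^2)"
proof -
  have "ell 1 a b = 2 * a + 1"
    using assms by (simp add: ell_def)
  then show ?thesis
    by (simp add: delta2_eq delta2_explicit_def Let_def) (simp add: power2_eq_square field_simps)
qed

lemma delta2_right:
  assumes "1 \<le> 2 * a" "b \<le> 2 * a - 1"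
  shows "delta2 m1 m2 (a, b) =
    - 3 * a^2 / 2 + a * b - b^2 / 2 + 2 * a - b + m1 * (1 - a^2) + m2 * (2 - b - b^2)"
proof -
  have "ell 1 a b = b + 2"
    using assms by (simp add: ell_def)
  then show ?thesis
    by (simp add: delta2_eq delta2_explicit_def Let_def) (simp add: power2_eq_square field_simps)
qed

lemma P_cases:
  assumes "(a, b) \<in> P"
  obtains (lower_left) "2 * a \<le> 1" "b \<le> 0"
  | (upper_left) "0 \<le> b" "2 * a - 1 \<le> b"
  | (right) "1 \<le> 2 * a" "b \<le> 2 * a - 1"
  by (meson assms linorder_linear order_trans diff_ge_0_iff_ge)

section \<open>Tools for bounding the maximum\<close>

lemma js_R_eqI:
  assumes "(a, b) \<in> P" "delta2 m1 m2 (a, b) = v"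
    and "\<And>a b. (a, b) \<in> P \<Longrightarrow> delta2 m1 m2 (a, b) \<le> v"
  shows "js_R m1 m2 = v"
proof (rule antisym)
  show "js_R m1 m2 \<le> v"
    using js_R_is_max(1)[of m1 m2] assms(3) by auto
  show "v \<le> js_R m1 m2"
    using assms(1,2) js_R_is_max(2) by metis
qed

text \<open>\<open>1 - a^2\<close> and \<open>2 - b - b^2\<close> are the weights of
  \<open>m1\<close> and \<open>m2\<close> in \<open>delta2_shift\<close>; their bounds control how
  the value changes as the parameters move away from a vertex. The last bound serves the direction
  \<open>(3, - 2)\<close>.\<close>

lemma P_weights:
  assumes "(a, b) \<in> P"
  shows "0 \<le> 1 - a^2" "1 - a^2 \<le> 1" "2 - b - b^2 \<le> 9 / 4" "3 * (1 - a^2) \<le> 2 * (2 - b - b^2)"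
proof -
  have P: "- a \<le> b" "a - 1 \<le> b" "b \<le> a" "a \<le> 1"
    using assms by (auto simp: P_iff)
  have "0 \<le> (1 - a) * (1 + a)"
    using P by (intro mult_nonneg_nonneg) auto
  then show "0 \<le> 1 - a^2"
    by (simp add: power2_eq_square algebra_simps)
  show "1 - a^2 \<le> 1"
    by simp
  have "0 \<le> (b + 1 / 2)^2"
    by simp
  then show "2 - b - b^2 \<le> 9 / 4"
    by (simp add: power2_eq_square algebra_simps)
  \<comment> \<open>The difference of the two sides is
    \<open>2 * (a - b) * (a + b + 1) + (1 - a)^2\<close>.\<close>
  have "0 \<le> (a - b) * (a + b + 1)" "0 \<le> (1 - a)^2"
    using P by (auto intro!: mult_nonneg_nonneg)
  then show "3 * (1 - a^2) \<le> 2 * (2 - b - b^2)"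
    by (simp add: power2_eq_square algebra_simps)
qed

text \<open>The right-hand side is the value at \<open>(a, - a)\<close>, the point of the left lower
  edge below \<open>(a, b)\<close>.\<close>

lemma delta2_le_edge_left:
  assumes "(a, b) \<in> P" "2 * a \<le> 1" "0 \<le> m2"
  shows "delta2 m1 m2 (a, b) \<le> a^2 + 1 / 2 + m1 * (1 - a^2) + m2 * (2 + a - a^2)"
proof -
  have P: "- a \<le> b" "a - 1 \<le> b" "b \<le> a" "a \<le> 1"
    using assms by (auto simp: P_iff)
  \<comment> \<open>The factors are the slacks of the two lower edges; the product is the difference
    of the two \<open>m2\<close> weights.\<close>
  have "0 \<le> (a + b) * (1 - a + b)"
    using P by (intro mult_nonneg_nonneg) auto
  then have "m2 * (2 - b - b^2) \<le> m2 * (2 + a - a^2)"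
    using assms by (intro mult_left_mono) (auto simp: power2_eq_square algebra_simps)
  moreover have "delta2 0 0 (a, b) \<le> a^2 + 1 / 2"
  proof (cases "b \<le> 0")
    case True
    have "0 \<le> (a + b)^2"
      by simp
    then show ?thesis
      using delta2_lower_left[of a b 0 0] True assms by (simp add: power2_eq_square algebra_simps)
  next
    case False
    have "0 \<le> (a - b)^2" "0 \<le> b^2"
      by auto
    moreover have "delta2 0 0 (a, b) = a^2 / 2 + a * b - b^2 - b + 1 / 2"
      using False assms by (simp add: delta2_upper_left)
    ultimately show ?thesis
      using False unfolding power2_eq_square by (simp only: algebra_simps)
  qed
  ultimately show ?thesis
    using delta2_shift[of m1 m2 a b 0 0] by simp
qed

text \<open>The right-hand side is the value at \<open>(a, a - 1)\<close>. Its \<open>m2\<close>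
  weight agrees with the one at \<open>(a, - a)\<close> because \<open>2 - b - b^2\<close> is
  symmetric about \<open>b = - 1 / 2\<close>.\<close>

lemma delta2_le_edge_right:
  assumes "(a, b) \<in> P" "1 \<le> 2 * a" "0 \<le> m2"
  shows "delta2 m1 m2 (a, b) \<le> a - a^2 + 1 / 2 + m1 * (1 - a^2) + m2 * (2 + a - a^2)"
proof -
  have P: "- a \<le> b" "a - 1 \<le> b" "b \<le> a" "a \<le> 1"
    using assms by (auto simp: P_iff)
  have "0 \<le> (a + b) * (1 - a + b)"
    using P by (intro mult_nonneg_nonneg) auto
  then have "m2 * (2 - b - b^2) \<le> m2 * (2 + a - a^2)"
    using assms by (intro mult_left_mono) (auto simp: power2_eq_square algebra_simps)
  moreover have "delta2 0 0 (a, b) \<le> a - a^2 + 1 / 2"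
  proof (cases "b \<le> 2 * a - 1")
    case True
    have "0 \<le> (a - b - 1)^2"
      by simp
    then show ?thesis
      using delta2_right[of a b 0 0] True assms by (simp add: power2_eq_square algebra_simps)
  next
    case False
    then have "0 \<le> (b - 2 * a + 1) * (a + b)" "0 \<le> a^2"
      using P by (auto intro!: mult_nonneg_nonneg)
    moreover have "delta2 0 0 (a, b) = a^2 / 2 + a * b - b^2 - b + 1 / 2"
      using False assms by (simp add: delta2_upper_left)
    ultimately show ?thesis
      unfolding power2_eq_square by (simp only: algebra_simps)
  qed
  ultimately show ?thesis
    using delta2_shift[of m1 m2 a b 0 0] by simp
qed

text \<open>The point slides horizontally until \<open>b + 2\<close> becomes the minimum in
  \<open>ell\<close>: to \<open>a' = 1 / 2\<close> for \<open>b \<le> 0\<close>, to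
  \<open>a' = (1 + b) / 2\<close> for \<open>0 \<le> b\<close>.\<close>

lemma delta2_le_right:
  assumes "(a, b) \<in> P" "m1 \<le> 0"
  obtains a' where "(a', b) \<in> P" "1 \<le> 2 * a'" "b \<le> 2 * a' - 1"
    "delta2 m1 m2 (a, b) \<le> delta2 m1 m2 (a', b)"
  using assms(1)
proof (cases rule: P_cases)
  case lower_left
  have P: "- a \<le> b" "a - 1 \<le> b" "b \<le> a" "a \<le> 1"
    using assms by (auto simp: P_iff)
  show ?thesis
  proof (rule that[of "1 / 2"])
    show "(1 / 2, b) \<in> P"
      using P lower_left by (auto simp: P_iff)
    have "0 \<le> (1 / 2 - m1) * ((1 / 2 - a) * (1 / 2 + a))" "(1 / 2 - a) * b \<le> 0"
      using P lower_left assms by (auto intro!: mult_nonneg_nonneg mult_nonneg_nonpos)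
    then show "delta2 m1 m2 (a, b) \<le> delta2 m1 m2 (1 / 2, b)"
      using delta2_lower_left[of a b m1 m2] delta2_lower_left[of "1 / 2" b m1 m2] lower_left
      by (simp add: power2_eq_square algebra_simps)
  qed (use lower_left in auto)
next
  case upper_left
  have P: "- a \<le> b" "a - 1 \<le> b" "b \<le> a" "a \<le> 1"
    using assms by (auto simp: P_iff)
  show ?thesis
  proof (rule that[of "(1 + b) / 2"])
    show "((1 + b) / 2, b) \<in> P"
      unfolding P_iff using P upper_left by argo
    define c where "c = (1 + b) / 2"
    have "0 \<le> (1 / 2 - m1) * ((c - a) * (c + a))" "0 \<le> (c - a) * b"
      using P upper_left assms by (auto intro!: mult_nonneg_nonneg simp: c_def)
    moreover have "2 * c - 1 \<le> b"
      unfolding c_def by argo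
    ultimately have "delta2 m1 m2 (a, b) \<le> delta2 m1 m2 (c, b)"
      using delta2_upper_left[of b a m1 m2] delta2_upper_left[of b c m1 m2] upper_left
      by (simp add: power2_eq_square algebra_simps)
    then show "delta2 m1 m2 (a, b) \<le> delta2 m1 m2 ((1 + b) / 2, b)"
      by (simp only: c_def)
  qed (use upper_left in argo)+
next
  case right
  then show ?thesis
    using that assms by blast
qed

text \<open>After the slide to the right region, the gap times the positive factor
  \<open>4 * (m2 + 1 / 2)\<close> is a sum of nonnegative terms. The bound also settles the vertex
  \<open>(0, - 1 / 3)\<close>.\<close>

lemma delta2_le_cell5:
  assumes "(a, b) \<in> P" "- 1 / 3 \<le> m2" "m2 \<le> 0" "1 + 2 * m1 + 3 * m2 + 4 * m1 * m2 \<le> 0"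
  shows "delta2 m1 m2 (a, b) \<le> (3 * m2 + 1)^2 / (4 * (m2 + 1 / 2))"
proof -
  have m1: "m1 \<le> 0"
  proof (rule ccontr)
    assume "\<not> m1 \<le> 0"
    then have "0 < m1 * (1 + 2 * m2)"
      using assms by (intro mult_pos_pos) auto
    then show False
      using assms by (simp add: algebra_simps)
  qed
  obtain c where c: "(c, b) \<in> P" "1 \<le> 2 * c" "b \<le> 2 * c - 1"
    "delta2 m1 m2 (a, b) \<le> delta2 m1 m2 (c, b)"
    using delta2_le_right[OF assms(1) m1] .
  define q where "q = - (1 + 2 * m1 + 3 * m2 + 4 * m1 * m2)"
  have "c \<le> 1"
    using c by (auto simp: P_iff)
  then have "0 \<le> q * ((1 - c) * (1 + c))"
    using assms c by (intro mult_nonneg_nonneg) (auto simp: q_def)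
  moreover have "0 \<le> (1 - c)^2 * (1 + 3 * m2)"
    using assms by (intro mult_nonneg_nonneg) auto
  \<comment> \<open>All three terms vanish at \<open>c = 1\<close>,
    \<open>b = - m2 / (1 + 2 * m2)\<close>, the maximiser for this cell.\<close>
  moreover have "(3 * m2 + 1)^2 - delta2 m1 m2 (c, b) * (4 * (m2 + 1 / 2)) =
      ((1 + 2 * m2) * b + m2 + (1 - c))^2 + (1 - c)^2 * (1 + 3 * m2) + q * ((1 - c) * (1 + c))"
    unfolding delta2_right[OF c(2,3)] q_def by (simp add: power2_eq_square algebra_simps)
  ultimately have "delta2 m1 m2 (c, b) * (4 * (m2 + 1 / 2)) \<le> (3 * m2 + 1)^2"
    by (smt (verit) zero_le_power2)
  then have "delta2 m1 m2 (c, b) \<le> (3 * m2 + 1)^2 / (4 * (m2 + 1 / 2))"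
    using assms by (subst pos_le_divide_eq) auto
  then show ?thesis
    using c by simp
qed

text \<open>The bounds are the common values of the affine formulas at the corners where their cells
  meet.\<close>

lemma delta2_vertices:
  assumes "(a, b) \<in> P"
  shows "delta2 1 0 (a, b) \<le> 3 / 2" "delta2 0 (- 1 / 3) (a, b) \<le> 0"
    "delta2 (1 / 2) (- 1 / 2) (a, b) \<le> 0" "delta2 (3 / 2) (- 1) (a, b) \<le> 0"
proof -
  have P: "- a \<le> b" "a - 1 \<le> b" "b \<le> a" "a \<le> 1"
    using assms by (auto simp: P_iff)
  show "delta2 1 0 (a, b) \<le> 3 / 2"
  proof (cases "2 * a \<le> 1")
    case True
    then show ?thesis
      using delta2_le_edge_left[OF assms, of 0 1] by simp
  next
    case False
    then have "0 \<le> a * (2 * a - 1)"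
      by (intro mult_nonneg_nonneg) auto
    then show ?thesis
      using False delta2_le_edge_right[OF assms, of 0 1]
      unfolding power2_eq_square by (simp only: algebra_simps) linarith
  qed
  show "delta2 0 (- 1 / 3) (a, b) \<le> 0"
    using delta2_le_cell5[OF assms, of "- 1 / 3" 0] by simp
  \<comment> \<open>In each region the value is a negative multiple of the product of its two
    defining slacks.\<close>
  show "delta2 (1 / 2) (- 1 / 2) (a, b) \<le> 0"
    using assms
  proof (cases rule: P_cases)
    case lower_left
    then have "0 \<le> (1 / 2 - a) * (- b)"
      by (intro mult_nonneg_nonneg) auto
    with lower_left show ?thesis
      by (simp add: delta2_lower_left power2_eq_square field_simps)
  next
    case upper_left
    then have "0 \<le> b * (1 + b - 2 * a)"
      by (intro mult_nonneg_nonneg) auto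
    with upper_left show ?thesis
      by (simp add: delta2_upper_left power2_eq_square field_simps)
  next
    case right
    then have "0 \<le> (2 * a - 1) * (2 * a - 1 - b)"
      by (intro mult_nonneg_nonneg) auto
    with right show ?thesis
      by (simp add: delta2_right power2_eq_square field_simps)
  qed
  show "delta2 (3 / 2) (- 1) (a, b) \<le> 0"
    using assms
  proof (cases rule: P_cases)
    case lower_left
    then have "b * (2 - 2 * a + b) \<le> 0" "0 \<le> a^2"
      using P by (auto intro: mult_nonpos_nonneg)
    moreover have "delta2 (3 / 2) (- 1) (a, b) = - (a^2) + (b * (2 - 2 * a + b)) / 2"
      using lower_left by (simp add: delta2_lower_left power2_eq_square field_simps)
    ultimately show ?thesis
      by argo
  next
    case upper_left
    then have "0 \<le> a * (a - b)"
      using P by (intro mult_nonneg_nonneg) auto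
    with upper_left show ?thesis
      by (simp add: delta2_upper_left power2_eq_square field_simps)
  next
    case right
    \<comment> \<open>convexity in \<open>b\<close> between \<open>a - 1\<close> and \<open>2 a - 1\<close>\<close>
    then have "0 \<le> (b - a + 1) * (2 * a - 1 - b)" "0 \<le> (2 * a - 1 - b) * a" "0 \<le> (b - a + 1) * (1 - a)"
      using P by (auto intro!: mult_nonneg_nonneg)
    moreover have "0 \<le> a^2"
      by simp
    ultimately show ?thesis
      using right by (simp add: delta2_right power2_eq_square field_simps)
  qed
qed

section \<open>The nine cells\<close>

lemma quadratic_le_vertex:
  fixes c p t :: real
  assumes "0 < c"
  shows "p * t - c * t^2 \<le> p^2 / (4 * c)"
proof -
  have "0 \<le> (2 * c * t - p)^2"
    by simp
  then have "(p * t - c * t^2) * (4 * c) \<le> p^2"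
    by (simp add: power2_eq_square algebra_simps)
  then show ?thesis
    using assms by (simp add: pos_le_divide_eq)
qed

text \<open>Along the left lower edge the value is a parabola in \<open>a\<close> with leading
  coefficient \<open>- c\<close>; the hypotheses place its critical point \<open>t\<close> between
  \<open>0\<close> and \<open>1 / 2\<close>, hence on that edge.\<close>

lemma js_R_cell1:
  assumes "1 < m1" "0 \<le> m2"
  shows "js_R m1 m2 = (m1 - 1)^2 / (4 * (m1 + m2 - 1)) + (3 * m1 + 9 * m2 + 3) / 4"
proof -
  define c where "c = m1 + m2 - 1"
  have c: "0 < c" "m1 = c - m2 + 1" "m2 \<le> c"
    using assms by (auto simp: c_def)
  \<comment> \<open>With \<open>m1 - 1 = c - m2\<close> the claimed value becomes the vertex value
    of the parabola.\<close>
  have V: "(m1 - 1)^2 / (4 * (m1 + m2 - 1)) + (3 * m1 + 9 * m2 + 3) / 4 =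
      m2^2 / (4 * c) + 1 / 2 + m1 + 2 * m2"
    using c(1) by (simp add: c(2) field_simps power2_eq_square)
  define t where "t = m2 / (2 * c)"
  have t: "0 \<le> t" "2 * t \<le> 1"
    using c assms by (auto simp: t_def field_simps)
  have left: "a^2 + 1 / 2 + m1 * (1 - a^2) + m2 * (2 + a - a^2) =
      m2 * a - c * a^2 + 1 / 2 + m1 + 2 * m2" for a
    by (simp add: c_def algebra_simps)
  show ?thesis
    unfolding V
  proof (rule js_R_eqI)
    show "(t, - t) \<in> P"
      using t by (auto simp: P_iff)
    have "delta2 m1 m2 (t, - t) = m2 * t - c * t^2 + 1 / 2 + m1 + 2 * m2"
      using t by (simp add: delta2_lower_left c_def power2_eq_square algebra_simps)
    also have "m2 * t - c * t^2 = m2^2 / (4 * c)"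
      using c(1) by (simp add: t_def field_simps power2_eq_square)
    finally show "delta2 m1 m2 (t, - t) = m2^2 / (4 * c) + 1 / 2 + m1 + 2 * m2" .
  next
    fix a b
    assume ab: "(a, b) \<in> P"
    show "delta2 m1 m2 (a, b) \<le> m2^2 / (4 * c) + 1 / 2 + m1 + 2 * m2"
    proof (cases "2 * a \<le> 1")
      case True
      then show ?thesis
        using delta2_le_edge_left[OF ab True assms(2), of m1] quadratic_le_vertex[OF c(1), of m2 a]
        unfolding left by linarith
    next
      case False
      \<comment> \<open>on the right lower edge the value decreases, so compare with its left end point\<close>
      have "0 \<le> m1 * ((a - 1 / 2) * (a + 1 / 2))" "0 \<le> (1 + m2) * (a - 1 / 2)^2"
        using False assms by (auto intro!: mult_nonneg_nonneg)
      then have "a - a^2 + 1 / 2 + m1 * (1 - a^2) + m2 * (2 + a - a^2) \<le>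
          m2 * (1 / 2) - c * (1 / 2)^2 + 1 / 2 + m1 + 2 * m2"
        unfolding c_def power2_eq_square by (simp add: field_simps)
      then show ?thesis
        using delta2_le_edge_right[OF ab _ assms(2), of m1] False
          quadratic_le_vertex[OF c(1), of m2 "1 / 2"] by linarith
    qed
  qed
qed

text \<open>The maximiser \<open>(1/2, - 1/2)\<close> gives \<open>m2\<close> its largest weight
  \<open>9 / 4\<close>. The parameters are a convex combination of two neighbouring vertices plus a
  nonnegative multiple of \<open>(0, 1)\<close>; the split at \<open>m1 = 1 / 2\<close> selects the
  two vertices.\<close>

lemma js_R_cell2:
  assumes "0 \<le> m1" "m1 \<le> 1" "0 \<le> 1 + m1 + 3 * m2" "0 \<le> 1 - m1 + m2"
  shows "js_R m1 m2 = (3 * m1 + 9 * m2 + 3) / 4"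
proof (rule js_R_eqI)
  show "(1 / 2, - 1 / 2) \<in> P"
    by (simp add: P_iff)
  show "delta2 m1 m2 (1 / 2, - 1 / 2) = (3 * m1 + 9 * m2 + 3) / 4"
    by (simp add: delta2_lower_left power2_eq_square field_simps)
next
  fix a b
  assume ab: "(a, b) \<in> P"
  define w where "w = 2 - b - b^2"
  have w: "w \<le> 9 / 4"
    using P_weights(3)[OF ab] by (simp add: w_def)
  note v = delta2_vertices[OF ab]
  show "delta2 m1 m2 (a, b) \<le> (3 * m1 + 9 * m2 + 3) / 4"
  proof (cases "2 * m1 \<le> 1")
    case True
    have "delta2 m1 m2 (a, b) = (1 - 2 * m1) * delta2 0 (- 1 / 3) (a, b)
        + 2 * m1 * delta2 (1 / 2) (- 1 / 2) (a, b) + (m2 + (1 + m1) / 3) * w"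
      unfolding delta2_shift[of m1 m2 a b 0 0] delta2_shift[of 0 "- 1 / 3" a b 0 0]
        delta2_shift[of "1 / 2" "- 1 / 2" a b 0 0] w_def by (simp add: field_simps)
    moreover have "(1 - 2 * m1) * delta2 0 (- 1 / 3) (a, b) \<le> 0"
      "2 * m1 * delta2 (1 / 2) (- 1 / 2) (a, b) \<le> 0"
      using v True assms by (auto intro!: mult_nonneg_nonpos)
    moreover have "(m2 + (1 + m1) / 3) * w \<le> (m2 + (1 + m1) / 3) * (9 / 4)"
      using w assms by (intro mult_left_mono) argo+
    ultimately show ?thesis
      by argo
  next
    case False
    have "delta2 m1 m2 (a, b) = (2 - 2 * m1) * delta2 (1 / 2) (- 1 / 2) (a, b)
        + (2 * m1 - 1) * delta2 1 0 (a, b) + (m2 + 1 - m1) * w"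
      unfolding delta2_shift[of m1 m2 a b 0 0] delta2_shift[of 1 0 a b 0 0]
        delta2_shift[of "1 / 2" "- 1 / 2" a b 0 0] w_def by (simp add: field_simps)
    moreover have "(2 - 2 * m1) * delta2 (1 / 2) (- 1 / 2) (a, b) \<le> 0"
      using v assms by (intro mult_nonneg_nonpos) auto
    moreover have "(2 * m1 - 1) * delta2 1 0 (a, b) \<le> (2 * m1 - 1) * (3 / 2)"
      using v False by (intro mult_left_mono) auto
    moreover have "(m2 + 1 - m1) * w \<le> (m2 + 1 - m1) * (9 / 4)"
      using w assms by (intro mult_left_mono) auto
    ultimately show ?thesis
      by argo
  qed
qed

text \<open>The parabola now lives on the right lower edge; \<open>m1 \<le> 0\<close> amounts to
  \<open>1 \<le> 2 * t\<close> and \<open>- 1 - 2 * m1 \<le> m2\<close> to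
  \<open>t \<le> 1\<close>.\<close>

lemma js_R_cell3:
  assumes "m1 \<le> 0" "0 \<le> m2" "- 1 - 2 * m1 \<le> m2"
  shows "js_R m1 m2 = m1^2 / (4 * (m1 + m2 + 1)) + (3 * m1 + 9 * m2 + 3) / 4"
proof -
  define c where "c = 1 + m1 + m2"
  have c: "0 < c" "m1 = c - m2 - 1" "1 + m2 \<le> 2 * c" "c \<le> 1 + m2"
    using assms by (auto simp: c_def)
  have V: "m1^2 / (4 * (m1 + m2 + 1)) + (3 * m1 + 9 * m2 + 3) / 4 =
      (1 + m2)^2 / (4 * c) + 1 / 2 + m1 + 2 * m2"
    using c(1) by (simp add: c(2) field_simps power2_eq_square)
  define t where "t = (1 + m2) / (2 * c)"
  have t: "1 \<le> 2 * t" "t \<le> 1"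
    using c by (auto simp: t_def field_simps)
  have right: "a - a^2 + 1 / 2 + m1 * (1 - a^2) + m2 * (2 + a - a^2) =
      (1 + m2) * a - c * a^2 + 1 / 2 + m1 + 2 * m2" for a
    by (simp add: c_def algebra_simps)
  show ?thesis
    unfolding V
  proof (rule js_R_eqI)
    show "(t, t - 1) \<in> P"
      using t by (auto simp: P_iff)
    have "delta2 m1 m2 (t, t - 1) = (1 + m2) * t - c * t^2 + 1 / 2 + m1 + 2 * m2"
      using t by (simp add: delta2_right c_def power2_eq_square field_simps)
    also have "(1 + m2) * t - c * t^2 = (1 + m2)^2 / (4 * c)"
      using c(1) by (simp add: t_def field_simps power2_eq_square)
    finally show "delta2 m1 m2 (t, t - 1) = (1 + m2)^2 / (4 * c) + 1 / 2 + m1 + 2 * m2" .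
  next
    fix a b
    assume ab: "(a, b) \<in> P"
    show "delta2 m1 m2 (a, b) \<le> (1 + m2)^2 / (4 * c) + 1 / 2 + m1 + 2 * m2"
    proof (cases "2 * a \<le> 1")
      case False
      then show ?thesis
        using delta2_le_edge_right[OF ab _ assms(2), of m1] quadratic_le_vertex[OF c(1), of "1 + m2" a]
        unfolding right by linarith
    next
      case True
      \<comment> \<open>on the left lower edge the value increases, so compare with its right end point\<close>
      have "0 \<le> a"
        using ab by (auto simp: P_iff)
      then have "0 \<le> (1 - m1) * ((1 / 2 - a) * (1 / 2 + a))" "0 \<le> m2 * (1 / 2 - a)^2"
        using True assms by (auto intro!: mult_nonneg_nonneg)
      then have "a^2 + 1 / 2 + m1 * (1 - a^2) + m2 * (2 + a - a^2) \<le>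
          (1 + m2) * (1 / 2) - c * (1 / 2)^2 + 1 / 2 + m1 + 2 * m2"
        unfolding c_def power2_eq_square by (simp add: field_simps)
      then show ?thesis
        using delta2_le_edge_left[OF ab True assms(2), of m1]
          quadratic_le_vertex[OF c(1), of "1 + m2" "1 / 2"] by linarith
    qed
  qed
qed

text \<open>The second hypothesis says that the parabola on the right lower edge has nonnegative
  slope at \<open>a = 1\<close>, which pushes the maximum to the corner
  \<open>(1, 0)\<close>.\<close>

lemma js_R_cell4:
  assumes "0 < m2" "1 + 2 * m1 + m2 \<le> 0"
  shows "js_R m1 m2 = 2 * m2 + 1 / 2"
proof (rule js_R_eqI)
  show "(1, 0) \<in> P"
    by (simp add: P_iff)
  show "delta2 m1 m2 (1, 0) = 2 * m2 + 1 / 2"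
    by (simp add: delta2_right)
next
  fix a b
  assume ab: "(a, b) \<in> P"
  then have a: "0 \<le> a" "a \<le> 1"
    by (auto simp: P_iff)
  \<comment> \<open>Since \<open>1 - a^2 = 2 * a * (1 - a) + (1 - a)^2\<close>, the gap on the right
    edge is the first product minus the second.\<close>
  then have 1: "0 \<le> (- (1 + 2 * m1 + m2)) * (a * (1 - a))" "m1 * (1 - a)^2 \<le> 0"
    using assms by (auto intro!: mult_nonneg_nonneg mult_nonpos_nonneg)
  show "delta2 m1 m2 (a, b) \<le> 2 * m2 + 1 / 2"
  proof (cases "2 * a \<le> 1")
    case True
    \<comment> \<open>The left edge expression is the right one minus this product.\<close>
    then have "0 \<le> a * (1 - 2 * a)"
      using a by (intro mult_nonneg_nonneg) auto
    with 1 have "a^2 + 1 / 2 + m1 * (1 - a^2) + m2 * (2 + a - a^2) \<le> 2 * m2 + 1 / 2"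
      by (simp add: power2_eq_square algebra_simps)
    then show ?thesis
      using delta2_le_edge_left[OF ab True, of m2 m1] assms by linarith
  next
    case False
    have "a - a^2 + 1 / 2 + m1 * (1 - a^2) + m2 * (2 + a - a^2) \<le> 2 * m2 + 1 / 2"
      using 1 by (simp add: power2_eq_square algebra_simps)
    then show ?thesis
      using delta2_le_edge_right[OF ab, of m2 m1] False assms by linarith
  qed
qed

lemma js_R_cell5:
  assumes "- 1 / 3 \<le> m2" "m2 \<le> 0" "1 + 2 * m1 + 3 * m2 + 4 * m1 * m2 \<le> 0"
  shows "js_R m1 m2 = (3 * m2 + 1)^2 / (4 * (m2 + 1 / 2))"
proof -
  define k where "k = 1 + 2 * m2"
  have k: "0 < k" "m2 = (k - 1) / 2" "1 \<le> 3 * k" "k \<le> 1"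
    using assms by (auto simp: k_def)
  \<comment> \<open>The critical point on the edge \<open>a = 1\<close>;
    \<open>- 1 / 3 \<le> m2\<close> gives \<open>t \<le> 1\<close>.\<close>
  define t where "t = - m2 / k"
  have t: "0 \<le> t" "t \<le> 1"
    using k by (auto simp: t_def field_simps)
  show ?thesis
  proof (rule js_R_eqI)
    show "(1, t) \<in> P"
      using t by (auto simp: P_iff)
    have "delta2 m1 m2 (1, t) = 1 / 2 - t^2 / 2 + m2 * (2 - t - t^2)"
      using t by (simp add: delta2_right)
    also have "\<dots> = (3 * m2 + 1)^2 / (4 * (m2 + 1 / 2))"
      using k(1) by (simp add: t_def k(2) field_simps power2_eq_square)
    finally show "delta2 m1 m2 (1, t) = (3 * m2 + 1)^2 / (4 * (m2 + 1 / 2))" .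
  qed (use delta2_le_cell5 assms in blast)
qed

text \<open>Both weights vanish at \<open>(1, 1)\<close>, so \<open>0\<close> is always attained.
  For the bound, \<open>(m1, m2)\<close> is compared with the point at the same height on the chain
  \<open>(0, - 1/3)\<close>, \<open>(1/2, - 1/2)\<close>, \<open>(3/2, - 1)\<close>, continued by a
  ray of direction \<open>(3, - 2)\<close>; it lies on or to the left of this chain.\<close>

lemma js_R_cell6:
  assumes "m2 \<le> - 1 / 3" "1 + m1 + 3 * m2 \<le> 0" "1 + 2 * m1 + 4 * m2 \<le> 0" "m2 \<le> - 2 / 3 * m1"
  shows "js_R m1 m2 = 0"
proof (rule js_R_eqI)
  show "(1, 1) \<in> P"
    by (simp add: P_iff)
  show "delta2 m1 m2 (1, 1) = 0"
    by (simp add: delta2_right)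
next
  fix a b
  assume ab: "(a, b) \<in> P"
  note w = P_weights[OF ab]
  note v = delta2_vertices[OF ab]
  consider "- 1 / 2 \<le> m2" | "- 1 \<le> m2" "m2 \<le> - 1 / 2" | "m2 \<le> - 1"
    by linarith
  then show "delta2 m1 m2 (a, b) \<le> 0"
  proof cases
    case 1
    have "delta2 m1 m2 (a, b) = (6 * m2 + 3) * delta2 0 (- 1 / 3) (a, b)
        + (- 2 - 6 * m2) * delta2 (1 / 2) (- 1 / 2) (a, b) + (1 + m1 + 3 * m2) * (1 - a^2)"
      unfolding delta2_shift[of m1 m2 a b 0 0] delta2_shift[of 0 "- 1 / 3" a b 0 0]
        delta2_shift[of "1 / 2" "- 1 / 2" a b 0 0] by (simp add: field_simps)
    moreover have "(6 * m2 + 3) * delta2 0 (- 1 / 3) (a, b) \<le> 0"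
      "(- 2 - 6 * m2) * delta2 (1 / 2) (- 1 / 2) (a, b) \<le> 0"
      using v 1 assms by (auto intro!: mult_nonneg_nonpos)
    moreover have "(1 + m1 + 3 * m2) * (1 - a^2) \<le> 0"
      using w assms by (intro mult_nonpos_nonneg) auto
    ultimately show ?thesis
      by linarith
  next
    case 2
    have "delta2 m1 m2 (a, b) = (2 * m2 + 2) * delta2 (1 / 2) (- 1 / 2) (a, b)
        + (- 1 - 2 * m2) * delta2 (3 / 2) (- 1) (a, b) + (m1 + 1 / 2 + 2 * m2) * (1 - a^2)"
      unfolding delta2_shift[of m1 m2 a b 0 0] delta2_shift[of "3 / 2" "- 1" a b 0 0]
        delta2_shift[of "1 / 2" "- 1 / 2" a b 0 0] by (simp add: field_simps)
    moreover have "(2 * m2 + 2) * delta2 (1 / 2) (- 1 / 2) (a, b) \<le> 0"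
      "(- 1 - 2 * m2) * delta2 (3 / 2) (- 1) (a, b) \<le> 0"
      using v 2 by (auto intro!: mult_nonneg_nonpos)
    moreover have "(m1 + 1 / 2 + 2 * m2) * (1 - a^2) \<le> 0"
      using w assms by (intro mult_nonpos_nonneg) auto
    ultimately show ?thesis
      by linarith
  next
    case 3
    have "delta2 m1 m2 (a, b) = delta2 (3 / 2) (- 1) (a, b)
        + (- 1 - m2) * (3 / 2 * (1 - a^2) - (2 - b - b^2)) + (m1 + 3 / 2 * m2) * (1 - a^2)"
      unfolding delta2_shift[of m1 m2 a b 0 0] delta2_shift[of "3 / 2" "- 1" a b 0 0]
      by (simp add: field_simps)
    moreover have "(- 1 - m2) * (3 / 2 * (1 - a^2) - (2 - b - b^2)) \<le> 0"
      using w 3 by (intro mult_nonneg_nonpos) auto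
    moreover have "(m1 + 3 / 2 * m2) * (1 - a^2) \<le> 0"
      using w assms by (intro mult_nonpos_nonneg) auto
    ultimately show ?thesis
      using v by linarith
  qed
qed

text \<open>At the apex the value vanishes along the whole upper edge \<open>b = a\<close>. On that
  edge only the parabola \<open>t * a - c * a^2 + c - t\<close> remains, and its critical point is
  the maximiser.\<close>

lemma js_R_cell7:
  assumes "- 2 / 3 * m1 < m2" "m2 \<le> - 1"
  shows "js_R m1 m2 = (2 * m1 + 3 * m2)^2 / (4 * (m1 + m2 - 1 / 2))"
proof -
  \<comment> \<open>Coordinates based at the apex:
    \<open>(m1, m2) = (3/2, - 1) + c * (1, 0) + t * (1, - 1)\<close>.\<close>
  define t where "t = - 1 - m2"
  define c where "c = m1 + m2 - 1 / 2"
  have c: "0 < c" "t \<le> 2 * c" "0 \<le> t" "m2 = - 1 - t" "m1 = 3 / 2 + c + t"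
    using assms by (auto simp: c_def t_def)
  have V: "(2 * m1 + 3 * m2)^2 / (4 * (m1 + m2 - 1 / 2)) = t^2 / (4 * c) + c - t"
    using c(1) by (simp add: c(4,5) field_simps power2_eq_square)
  define a where "a = t / (2 * c)"
  have a: "0 \<le> a" "a \<le> 1"
    using c by (auto simp: a_def field_simps)
  show ?thesis
    unfolding V
  proof (rule js_R_eqI)
    show "(a, a) \<in> P"
      using a by (auto simp: P_iff)
    have "delta2 m1 m2 (a, a) = t * a - c * a^2 + c - t"
      using a by (simp add: delta2_upper_left c(4,5) power2_eq_square field_simps)
    also have "t * a - c * a^2 = t^2 / (4 * c)"
      using c(1) by (simp add: a_def field_simps power2_eq_square)
    finally show "delta2 m1 m2 (a, a) = t^2 / (4 * c) + c - t" .
  next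
    fix a b
    assume ab: "(a, b) \<in> P"
    have "delta2 m1 m2 (a, b) = delta2 (3 / 2) (- 1) (a, b) + (t * a - c * a^2) + c - t
        - t * ((a - b) * (a + b + 1))"
      unfolding delta2_shift[of m1 m2 a b "3 / 2" "- 1"]
      by (simp add: c(4,5) power2_eq_square algebra_simps)
    moreover have "0 \<le> t * ((a - b) * (a + b + 1))"
      using ab c by (intro mult_nonneg_nonneg) (auto simp: P_iff)
    ultimately show "delta2 m1 m2 (a, b) \<le> t^2 / (4 * c) + c - t"
      using delta2_vertices(4)[OF ab] quadratic_le_vertex[OF c(1), of t a] by linarith
  qed
qed

text \<open>The maximiser \<open>(0, 0)\<close> gives \<open>m1\<close> its largest weight
  \<open>1\<close>, so the bound spreads to the right from the chain \<open>(1, 0)\<close>,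
  \<open>(1/2, - 1/2)\<close>, \<open>(3/2, - 1)\<close>.\<close>

lemma js_R_cell8:
  assumes "- 1 \<le> m2" "m2 \<le> 0" "1 - m1 + m2 \<le> 0" "0 \<le> 1 + 2 * m1 + 4 * m2"
  shows "js_R m1 m2 = m1 + 2 * m2 + 1 / 2"
proof (rule js_R_eqI)
  show "(0, 0) \<in> P"
    by (simp add: P_iff)
  show "delta2 m1 m2 (0, 0) = m1 + 2 * m2 + 1 / 2"
    by (simp add: delta2_lower_left)
next
  fix a b
  assume ab: "(a, b) \<in> P"
  note w = P_weights(2)[OF ab]
  note v = delta2_vertices[OF ab]
  show "delta2 m1 m2 (a, b) \<le> m1 + 2 * m2 + 1 / 2"
  proof (cases "- 1 / 2 \<le> m2")
    case True
    have "delta2 m1 m2 (a, b) = (1 + 2 * m2) * delta2 1 0 (a, b)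
        + (- 2 * m2) * delta2 (1 / 2) (- 1 / 2) (a, b) + (m1 - 1 - m2) * (1 - a^2)"
      unfolding delta2_shift[of m1 m2 a b 0 0] delta2_shift[of 1 0 a b 0 0]
        delta2_shift[of "1 / 2" "- 1 / 2" a b 0 0] by (simp add: field_simps)
    moreover have "(1 + 2 * m2) * delta2 1 0 (a, b) \<le> (1 + 2 * m2) * (3 / 2)"
      using v True by (intro mult_left_mono) auto
    moreover have "(- 2 * m2) * delta2 (1 / 2) (- 1 / 2) (a, b) \<le> 0"
      using v assms by (intro mult_nonneg_nonpos) auto
    moreover have "(m1 - 1 - m2) * (1 - a^2) \<le> (m1 - 1 - m2) * 1"
      using w assms by (intro mult_left_mono) auto
    ultimately show ?thesis
      by argo
  next
    case False
    have "delta2 m1 m2 (a, b) = (2 * m2 + 2) * delta2 (1 / 2) (- 1 / 2) (a, b)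
        + (- 1 - 2 * m2) * delta2 (3 / 2) (- 1) (a, b) + (m1 + 1 / 2 + 2 * m2) * (1 - a^2)"
      unfolding delta2_shift[of m1 m2 a b 0 0] delta2_shift[of "3 / 2" "- 1" a b 0 0]
        delta2_shift[of "1 / 2" "- 1 / 2" a b 0 0] by (simp add: field_simps)
    moreover have "(2 * m2 + 2) * delta2 (1 / 2) (- 1 / 2) (a, b) \<le> 0"
      "(- 1 - 2 * m2) * delta2 (3 / 2) (- 1) (a, b) \<le> 0"
      using v False assms by (auto intro!: mult_nonneg_nonpos)
    moreover have "(m1 + 1 / 2 + 2 * m2) * (1 - a^2) \<le> (m1 + 1 / 2 + 2 * m2) * 1"
      using w assms by (intro mult_left_mono) auto
    ultimately show ?thesis
      by argo
  qed
qed

text \<open>Twice \<open>D\<close> is the determinant of the negated Hessian of the quadratic polynomial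
  in \<open>delta2_right\<close>; the two squares vanish together exactly at its critical point.\<close>

lemma I_val_complete_square:
  fixes m1 m2 a b :: real
  defines "D \<equiv> 1 + m1 + 3 * m2 + 2 * m1 * m2"
  assumes "1 \<le> 2 * a" "b \<le> 2 * a - 1" "0 < D" "0 < 1 + 2 * m2"
  shows "I_val m1 m2 - delta2 m1 m2 (a, b) =
    (2 * D * ((1 + 2 * m2) * b - a + 1 + m2)^2 + (2 * D * a - (1 + 3 * m2))^2)
      / (4 * D * (1 + 2 * m2))"
proof -
  define N where "N = 3 + 6 * m1 + 4 * m1^2 + 18 * m2 + 24 * m1 * m2 + 8 * m1^2 * m2 + 27 * m2^2
    + 18 * m1 * m2^2"
  have "(1 + 2 * m2) * (N - 4 * D * delta2 m1 m2 (a, b)) =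
      2 * D * ((1 + 2 * m2) * b - a + 1 + m2)^2 + (2 * D * a - (1 + 3 * m2))^2"
    unfolding delta2_right[OF assms(2,3)] N_def D_def by (simp add: power2_eq_square algebra_simps)
  moreover have "I_val m1 m2 = N / (4 * D)"
    by (simp add: I_val_def N_def D_def)
  then have "I_val m1 m2 - delta2 m1 m2 (a, b) =
      (1 + 2 * m2) * (N - 4 * D * delta2 m1 m2 (a, b)) / (4 * D * (1 + 2 * m2))"
    using assms(4,5) by (simp add: diff_divide_distrib)
  ultimately show ?thesis
    by (simp only:)
qed

text \<open>The maximiser is the critical point of the quadratic on the right region, where both
  squares of \<open>I_val_complete_square\<close> vanish; the hypotheses place it inside that region
  of \<open>P\<close>.\<close>

lemma js_R_cell9:
  assumes "0 \<le> 1 + 2 * m1 + 3 * m2 + 4 * m1 * m2" "m1 \<le> 0" "- 1 / 3 \<le> m2" "m2 \<le> 0"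
    "(m1, m2) \<noteq> (0, - 1 / 3)"
  shows "js_R m1 m2 = I_val m1 m2"
proof -
  define D where "D = 1 + m1 + 3 * m2 + 2 * m1 * m2"
  have k: "0 < 1 + 2 * m2"
    using assms by simp
  \<comment> \<open>At \<open>m2 = - 1 / 3\<close> the first hypothesis reduces to
    \<open>0 \<le> m1\<close>, which leaves only the excluded point.\<close>
  have "- 1 / 3 < m2"
  proof (rule ccontr)
    assume "\<not> - 1 / 3 < m2"
    with assms(3) have "m2 = - 1 / 3"
      by simp
    with assms show False
      by simp
  qed
  \<comment> \<open>\<open>2 * D\<close> is the sum of \<open>1 + 3 * m2\<close> and the expression
    in the first hypothesis.\<close>
  then have D: "0 < D"
    using assms unfolding D_def by argo
  define a where "a = (1 + 3 * m2) / (2 * D)"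
  define b where "b = (a - 1 - m2) / (1 + 2 * m2)"
  \<comment> \<open>Over the denominator \<open>2 * D\<close>, inequalities between \<open>a\<close>
    and \<open>b\<close> reduce to their numerators.\<close>
  have b: "b = - (1 + 2 * m1 + 3 * m2 + 2 * m1 * m2) / (2 * D)"
  proof -
    have "(a - 1 - m2) * (2 * D) = - (1 + 2 * m1 + 3 * m2 + 2 * m1 * m2) * (1 + 2 * m2)"
      using D by (simp add: a_def diff_divide_distrib left_diff_distrib) (simp add: D_def algebra_simps)
    then show ?thesis
      using D k by (simp add: b_def frac_eq_eq)
  qed
  have prod: "m1 * (1 + 2 * m2) \<le> 0" "0 \<le> m1 * m2"
    using assms k by (auto intro: mult_nonpos_nonneg mult_nonpos_nonpos)
  have ab: "1 \<le> 2 * a" "a \<le> 1" "a - 1 \<le> b" "b \<le> 2 * a - 1"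
  proof -
    have "D \<le> 1 + 3 * m2"
      using prod by (simp add: D_def algebra_simps)
    then show "1 \<le> 2 * a"
      using D by (simp add: a_def field_simps)
    have "1 + 3 * m2 \<le> 2 * D"
      using assms(1) by (simp add: D_def algebra_simps)
    then show "a \<le> 1"
      using D by (simp add: a_def field_simps)
    have "1 + 3 * m2 - 2 * D \<le> - (1 + 2 * m1 + 3 * m2 + 2 * m1 * m2)"
      using prod by (simp add: D_def algebra_simps)
    moreover have "a - 1 = (1 + 3 * m2 - 2 * D) / (2 * D)"
      using D by (simp add: a_def field_simps)
    ultimately show "a - 1 \<le> b"
      using D unfolding b by (simp only:) (intro divide_right_mono; simp)
    \<comment> \<open>This product and \<open>(1 + 3 * m2)^2\<close> add up to
      \<open>(1 + 2 * m2) * (1 + 3 * m2 - 2 * m1 * m2)\<close>, whose last factor decides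
      \<open>b \<le> 2 * a - 1\<close>.\<close>
    have "0 \<le> (- m2) * (1 + 2 * m1 + 3 * m2 + 4 * m1 * m2)"
      using assms by (intro mult_nonneg_nonneg) auto
    moreover have "0 \<le> (1 + 3 * m2)^2"
      by simp
    ultimately have "0 \<le> (1 + 2 * m2) * (1 + 3 * m2 - 2 * m1 * m2)"
      by (simp add: power2_eq_square algebra_simps)
    then have "0 \<le> 1 + 3 * m2 - 2 * m1 * m2"
      using k by (simp add: zero_le_mult_iff)
    then have "- (1 + 2 * m1 + 3 * m2 + 2 * m1 * m2) \<le> 2 * (1 + 3 * m2) - 2 * D"
      by (simp add: D_def algebra_simps)
    moreover have "2 * a - 1 = (2 * (1 + 3 * m2) - 2 * D) / (2 * D)"
      using D by (simp add: a_def field_simps)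
    ultimately show "b \<le> 2 * a - 1"
      using D unfolding b by (simp only:) (intro divide_right_mono; simp)
  qed
  note square = I_val_complete_square[where ?m1.0 = m1 and ?m2.0 = m2, folded D_def, OF _ _ D k]
  show ?thesis
  proof (rule js_R_eqI)
    show "(a, b) \<in> P"
      using ab by (auto simp: P_iff)
    have "(1 + 2 * m2) * b - a + 1 + m2 = 0"
      using k by (simp add: b_def)
    moreover have "2 * D * a - (1 + 3 * m2) = 0"
      using D by (simp add: a_def)
    ultimately show "delta2 m1 m2 (a, b) = I_val m1 m2"
      using square[OF ab(1,4)] by simp
  next
    fix c d
    assume "(c, d) \<in> P"
    then obtain c' where c': "1 \<le> 2 * c'" "d \<le> 2 * c' - 1"
      "delta2 m1 m2 (c, d) \<le> delta2 m1 m2 (c', d)"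
      using delta2_le_right assms(2) by metis
    have "0 \<le> I_val m1 m2 - delta2 m1 m2 (c', d)"
      unfolding square[OF c'(1,2)] using D k by (intro divide_nonneg_nonneg add_nonneg_nonneg) auto
    then show "delta2 m1 m2 (c, d) \<le> I_val m1 m2"
      using c' by simp
  qed
qed

section \<open>Covering of the parameter plane\<close>

lemma cells_cover:
  fixes m1 m2 :: real
  shows "(m1 > 1 \<and> m2 \<ge> 0)
      \<or> (0 \<le> m1 \<and> m1 \<le> 1 \<and> 1 + m1 + 3 * m2 \<ge> 0 \<and> 1 - m1 + m2 \<ge> 0)
      \<or> (m1 \<le> 0 \<and> m2 \<ge> 0 \<and> m2 \<ge> - 1 - 2 * m1)
      \<or> (m2 > 0 \<and> 1 + 2 * m1 + m2 \<le> 0)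
      \<or> (- 1 / 3 \<le> m2 \<and> m2 \<le> 0 \<and> 1 + 2 * m1 + 3 * m2 + 4 * m1 * m2 \<le> 0)
      \<or> (m2 \<le> - 1 / 3 \<and> 1 + m1 + 3 * m2 \<le> 0 \<and> 1 + 2 * m1 + 4 * m2 \<le> 0 \<and> m2 \<le> - 2 / 3 * m1)
      \<or> (m2 > - 2 / 3 * m1 \<and> m2 \<le> - 1)
      \<or> (- 1 \<le> m2 \<and> m2 \<le> 0 \<and> 1 - m1 + m2 \<le> 0 \<and> 1 + 2 * m1 + 4 * m2 \<ge> 0)
      \<or> (1 + 2 * m1 + 3 * m2 + 4 * m1 * m2 \<ge> 0 \<and> - 1 / 2 \<le> m1 \<and> m1 \<le> 0 \<and> - 1 / 3 \<le> m2 \<and> m2 \<le> 0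
          \<and> (m1, m2) \<noteq> (0, - 1 / 3))"
    (is "?C1 \<or> ?C2 \<or> ?C3 \<or> ?C4 \<or> ?C5 \<or> ?C6 \<or> ?C7 \<or> ?C8 \<or> ?C9")
proof -
  \<comment> \<open>A coarse partition: two half planes, and the strip between them cut along
    \<open>m1 = 1 + m2\<close> and then along \<open>m1 = 0\<close> and
    \<open>m2 = - 1 / 3\<close>.\<close>
  consider (up) "0 < m2" | (down) "m2 \<le> - 1" | (right) "- 1 \<le> m2" "m2 \<le> 0" "1 - m1 + m2 \<le> 0"
    | (middle) "m2 \<le> 0" "0 \<le> 1 - m1 + m2" "0 \<le> m1 \<or> m2 \<le> - 1 / 3"
    | (left) "m1 < 0" "- 1 / 3 \<le> m2" "m2 \<le> 0"
    by linarith
  then consider ?C1 | ?C2 | ?C3 | ?C4 | ?C5 | ?C6 | ?C7 | ?C8 | ?C9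
  proof cases
    case up
    consider "1 < m1" | "0 \<le> m1" "m1 \<le> 1" | "m1 \<le> 0" "- 1 - 2 * m1 \<le> m2" | "1 + 2 * m1 + m2 \<le> 0"
      by linarith
    then show ?thesis
    proof cases
      case 1
      then show ?thesis using up by (intro that(1)) auto
    next
      case 2
      then show ?thesis using up by (intro that(2)) auto
    next
      case 3
      then show ?thesis using up by (intro that(3)) auto
    next
      case 4
      then show ?thesis using up by (intro that(4)) auto
    qed
  next
    case down
    show ?thesis
    proof (cases "- 2 / 3 * m1 < m2")
      case True
      then show ?thesis using down by (intro that(7)) auto
    next
      case False
      then show ?thesis using down by (intro that(6)) auto
    qed
  next
    case right
    show ?thesis
    proof (cases "0 \<le> 1 + 2 * m1 + 4 * m2")
      case True
      then show ?thesis using right by (intro that(8)) auto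
    next
      case False
      then show ?thesis using right by (intro that(6)) auto
    qed
  next
    case middle
    show ?thesis
    proof (cases "0 \<le> m1 \<and> 0 \<le> 1 + m1 + 3 * m2")
      case True
      then show ?thesis using middle by (intro that(2)) auto
    next
      case False
      then have "1 + m1 + 3 * m2 \<le> 0"
        using middle by linarith
      then show ?thesis using middle by (intro that(6)) auto
    qed
  next
    case left
    show ?thesis
    proof (cases "0 \<le> 1 + 2 * m1 + 3 * m2 + 4 * m1 * m2")
      case True
      \<comment> \<open>The case condition reads
        \<open>0 \<le> (1 + 2 * m1) * (1 + 2 * m2) + m2\<close>, where \<open>m2 \<le> 0\<close> and
        \<open>0 < 1 + 2 * m2\<close>.\<close>
      have "- 1 / 2 \<le> m1"
      proof (rule ccontr)
        assume "\<not> - 1 / 2 \<le> m1"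
        with left have "0 < (- 1 - 2 * m1) * (1 + 2 * m2)"
          by (intro mult_pos_pos) auto
        with True left show False
          by (simp add: algebra_simps)
      qed
      then show ?thesis using True left by (intro that(9)) auto
    next
      case False
      then show ?thesis using left by (intro that(5)) auto
    qed
  qed
  then show ?thesis
    by cases (simp_all only: simp_thms)
qed

theorem theorem4p2:
  fixes m1 m2 :: real
  shows
    "(m1 > 1 \<and> m2 \<ge> 0 \<longrightarrow>
        js_R m1 m2 = (m1 - 1)^2 / (4 * (m1 + m2 - 1)) + (3 * m1 + 9 * m2 + 3) / 4)
   \<and> (0 \<le> m1 \<and> m1 \<le> 1 \<and> 1 + m1 + 3 * m2 \<ge> 0 \<and> 1 - m1 + m2 \<ge> 0 \<longrightarrow>
        js_R m1 m2 = (3 * m1 + 9 * m2 + 3) / 4)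
   \<and> (m1 \<le> 0 \<and> m2 \<ge> 0 \<and> m2 \<ge> - 1 - 2 * m1 \<longrightarrow>
        js_R m1 m2 = m1^2 / (4 * (m1 + m2 + 1)) + (3 * m1 + 9 * m2 + 3) / 4)
   \<and> (m2 > 0 \<and> 1 + 2 * m1 + m2 \<le> 0 \<longrightarrow>
        js_R m1 m2 = 2 * m2 + 1 / 2)
   \<and> (- 1 / 3 \<le> m2 \<and> m2 \<le> 0 \<and> 1 + 2 * m1 + 3 * m2 + 4 * m1 * m2 \<le> 0 \<longrightarrow>
        js_R m1 m2 = (3 * m2 + 1)^2 / (4 * (m2 + 1 / 2)))
   \<and> (m2 \<le> - 1 / 3 \<and> 1 + m1 + 3 * m2 \<le> 0 \<and> 1 + 2 * m1 + 4 * m2 \<le> 0 \<and> m2 \<le> - 2 / 3 * m1 \<longrightarrow>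
        js_R m1 m2 = 0)
   \<and> (m2 > - 2 / 3 * m1 \<and> m2 \<le> - 1 \<longrightarrow>
        js_R m1 m2 = (2 * m1 + 3 * m2)^2 / (4 * (m1 + m2 - 1 / 2)))
   \<and> (- 1 \<le> m2 \<and> m2 \<le> 0 \<and> 1 - m1 + m2 \<le> 0 \<and> 1 + 2 * m1 + 4 * m2 \<ge> 0 \<longrightarrow>
        js_R m1 m2 = m1 + 2 * m2 + 1 / 2)
   \<and> (1 + 2 * m1 + 3 * m2 + 4 * m1 * m2 \<ge> 0 \<and> - 1 / 2 \<le> m1 \<and> m1 \<le> 0 \<and> - 1 / 3 \<le> m2 \<and> m2 \<le> 0
        \<and> (m1, m2) \<noteq> (0, - 1 / 3) \<longrightarrow>
        js_R m1 m2 = I_val m1 m2)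
   \<and> (\<comment> \<open>the nine cases cover the whole plane\<close>
        (m1 > 1 \<and> m2 \<ge> 0)
      \<or> (0 \<le> m1 \<and> m1 \<le> 1 \<and> 1 + m1 + 3 * m2 \<ge> 0 \<and> 1 - m1 + m2 \<ge> 0)
      \<or> (m1 \<le> 0 \<and> m2 \<ge> 0 \<and> m2 \<ge> - 1 - 2 * m1)
      \<or> (m2 > 0 \<and> 1 + 2 * m1 + m2 \<le> 0)
      \<or> (- 1 / 3 \<le> m2 \<and> m2 \<le> 0 \<and> 1 + 2 * m1 + 3 * m2 + 4 * m1 * m2 \<le> 0)
      \<or> (m2 \<le> - 1 / 3 \<and> 1 + m1 + 3 * m2 \<le> 0 \<and> 1 + 2 * m1 + 4 * m2 \<le> 0 \<and> m2 \<le> - 2 / 3 * m1)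
      \<or> (m2 > - 2 / 3 * m1 \<and> m2 \<le> - 1)
      \<or> (- 1 \<le> m2 \<and> m2 \<le> 0 \<and> 1 - m1 + m2 \<le> 0 \<and> 1 + 2 * m1 + 4 * m2 \<ge> 0)
      \<or> (1 + 2 * m1 + 3 * m2 + 4 * m1 * m2 \<ge> 0 \<and> - 1 / 2 \<le> m1 \<and> m1 \<le> 0 \<and> - 1 / 3 \<le> m2 \<and> m2 \<le> 0
          \<and> (m1, m2) \<noteq> (0, - 1 / 3)))"
  by (intro conjI impI cells_cover js_R_cell1 js_R_cell2 js_R_cell3 js_R_cell4 js_R_cell5 js_R_cell6
      js_R_cell7 js_R_cell8 js_R_cell9; elim conjE; assumption)

end
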